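(* Let $\gamma : I \to S_1^3\subset\mathbb{R}_1^4$ be a null helix parametrized by its pseudo-arc parameter, with Cartan frame $\{L,N,W_1,W_2\}$. Let $a\neq 0$ and $\theta\neq 0$ be real constants and let $c\in\mathbb{R}_1^4$ be a constant vector. Then the curve $$\tilde\gamma(s)=a\int L(\upsilon)\,d\upsilon + a\coth\theta\int W_2(\upsilon)\,d\upsilon + c$$ (where the integrals denote antiderivatives, evaluated at $s$) is a Bertrand curve.
   Context: $\mathbb{R}_1^4$ is $\mathbb{R}^4$ with the pseudo scalar product $\langle x,y\rangle=-x_1y_1+x_2y_2+x_3y_3+x_4y_4$, and $\|x\|=\sqrt{|\langle x,x\rangle|}$. A nonzero vector $x$ is spacelike, null (lightlike) or timelike if $\langle x,x\rangle>0$, $=0$ or $<0$ respectively. De Sitter 3-space is $S_1^3=\{x\in\mathbb{R}_1^4:\langle x,x\rangle=1\}$. Curves are smooth and defined on an open interval $I$. A regular curve $\gamma$ is null if $\gamma'(t)$ is null for every $t$. It is assumed that $\langle\gamma'',\gamma''\rangle$ never vanishes for the null curves considered. A null curve is parametrized by the pseudo-arc if $\langle\gamma'',\gamma''\rangle=1$. It is a Cartan curve if $\langle\gamma'',\gamma''\rangle\ne 0$ and $\gamma'(t),\gamma''(t),\gamma'''(t)$ are linearly independent for every $t$. For a Cartan curve in $\mathbb{R}_1^4$ with pseudo-arc parameter there is a pseudo orthonormal basis $\{L,N,W_1,W_2\}$ along $\gamma$ (the Cartan frame) and functions $k_1,k_2$ (the Cartan curvatures) such that $$L=\gamma',\quad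 L'=W_1,\quad N'=k_1W_1+k_2W_2,\quad W_1'=-k_1L-N,\quad W_2'=-k_2L,$$ where $\langle L,L\rangle=\langle N,N\rangle=0$, $\langle L,N\rangle=1$, $\langle W_1,W_1\rangle=\langle W_2,W_2\rangle=1$, and $\langle L,W_i\rangle=\langle N,W_i\rangle=\langle W_1,W_2\rangle=0$ for $i=1,2$. A null helix is a Cartan curve whose Cartan curvatures $k_1,k_2$ are constant. Curvatures and Bertrand curves: let $\beta$ be a regular curve in $\mathbb{R}_1^4$ with $\beta'$ nowhere null, put $v=\|\beta'\|$ and $T=\beta'/v$. The first curvature is $\kappa=\|T'\|/v$. If $T'$ is nowhere null and nowhere zero, put $N_1=T'/\|T'\|$; the second curvature is $\tau=\|B\|$, where $B$ is the component of $N_1'/v$ orthogonal to $T$. Such a curve $\beta$ is called a Bertrand curve if there exist real constants $\lambda,\mu$ such that $\lambda\kappa+\mu\tau=1$ along $\beta$. *)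

theory Defs
  imports "HOL-Analysis.Analysis"
begin

definition coth :: "real \<Rightarrow> real" where
  "coth x = cosh x / sinh x"

definition mink :: "real ^ 4 \<Rightarrow> real ^ 4 \<Rightarrow> real" where
  "mink x y = - (x $ 1 * y $ 1) + x $ 2 * y $ 2 + x $ 3 * y $ 3 + x $ 4 * y $ 4"

definition mink_norm :: "real ^ 4 \<Rightarrow> real" where
  "mink_norm x = sqrt \<bar>mink x x\<bar>"

definition null_vector :: "real ^ 4 \<Rightarrow> bool" where
  "null_vector x \<longleftrightarrow> x \<noteq> 0 \<and> mink x x = 0"

definition de_sitter3 :: "(real ^ 4) set" where
  "de_sitter3 = {x. mink x x = 1}"

(* On an open set of parameters, vderiv f depends only on the values of f there;
   elsewhere it is arbitrary, and it is never used elsewhere. *)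
definition vderiv :: "(real \<Rightarrow> 'a::real_normed_vector) \<Rightarrow> real \<Rightarrow> 'a" where
  "vderiv f t = vector_derivative f (at t)"

definition smooth_on :: "real set \<Rightarrow> (real \<Rightarrow> 'a::real_normed_vector) \<Rightarrow> bool" where
  "smooth_on I f \<longleftrightarrow> (\<forall>n. \<forall>t\<in>I. (vderiv ^^ n) f differentiable at t)"

definition curve :: "real set \<Rightarrow> (real \<Rightarrow> real ^ 4) \<Rightarrow> bool" where
  "curve I \<gamma> \<longleftrightarrow> I \<noteq> {} \<and> open I \<and> is_interval I \<and> smooth_on I \<gamma>"

definition regular_curve :: "real set \<Rightarrow> (real \<Rightarrow> real ^ 4) \<Rightarrow> bool" where
  "regular_curve I \<gamma> \<longleftrightarrow> curve I \<gamma> \<and> (\<forall>t\<in>I. vderiv \<gamma> t \<noteq> 0)"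

definition null_curve :: "real set \<Rightarrow> (real \<Rightarrow> real ^ 4) \<Rightarrow> bool" where
  "null_curve I \<gamma> \<longleftrightarrow> regular_curve I \<gamma> \<and> (\<forall>t\<in>I. null_vector (vderiv \<gamma> t))"

definition pseudo_arc :: "real set \<Rightarrow> (real \<Rightarrow> real ^ 4) \<Rightarrow> bool" where
  "pseudo_arc I \<gamma> \<longleftrightarrow> null_curve I \<gamma> \<and>
    (\<forall>t\<in>I. mink ((vderiv ^^ 2) \<gamma> t) ((vderiv ^^ 2) \<gamma> t) = 1)"

(* A set does not see repetitions, hence the additional distinctness. *)
definition lin_indep :: "'a::real_vector list \<Rightarrow> bool" where
  "lin_indep vs \<longleftrightarrow> distinct vs \<and> independent (set vs)"

definition cartan_curve :: "real set \<Rightarrow> (real \<Rightarrow> real ^ 4) \<Rightarrow> bool" where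
  "cartan_curve I \<gamma> \<longleftrightarrow> null_curve I \<gamma> \<and>
    (\<forall>t\<in>I. mink ((vderiv ^^ 2) \<gamma> t) ((vderiv ^^ 2) \<gamma> t) \<noteq> 0 \<and>
            lin_indep [vderiv \<gamma> t, (vderiv ^^ 2) \<gamma> t, (vderiv ^^ 3) \<gamma> t])"

definition pseudo_orthonormal_basis ::
    "real ^ 4 \<Rightarrow> real ^ 4 \<Rightarrow> real ^ 4 \<Rightarrow> real ^ 4 \<Rightarrow> bool" where
  "pseudo_orthonormal_basis l n w1 w2 \<longleftrightarrow>
    lin_indep [l, n, w1, w2] \<and> span {l, n, w1, w2} = UNIV \<and>
    mink l l = 0 \<and> mink n n = 0 \<and> mink l n = 1 \<and>
    mink w1 w1 = 1 \<and> mink w2 w2 = 1 \<and>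
    mink l w1 = 0 \<and> mink l w2 = 0 \<and> mink n w1 = 0 \<and> mink n w2 = 0 \<and> mink w1 w2 = 0"

(* The equations force <gamma'', gamma''> = <W1, W1> = 1, so such a frame exists only
   for the pseudo-arc parameter.  The frame determines k1 and k2; the pair (W2, k2)
   may be replaced by (-W2, -k2). *)
definition cartan_frame :: "real set \<Rightarrow> (real \<Rightarrow> real ^ 4) \<Rightarrow>
    (real \<Rightarrow> real ^ 4) \<Rightarrow> (real \<Rightarrow> real ^ 4) \<Rightarrow> (real \<Rightarrow> real ^ 4) \<Rightarrow> (real \<Rightarrow> real ^ 4) \<Rightarrow>
    (real \<Rightarrow> real) \<Rightarrow> (real \<Rightarrow> real) \<Rightarrow> bool" where
  "cartan_frame I \<gamma> L N W1 W2 k1 k2 \<longleftrightarrow>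
    (\<forall>t\<in>I. pseudo_orthonormal_basis (L t) (N t) (W1 t) (W2 t) \<and>
      L t = vderiv \<gamma> t \<and>
      (L has_vector_derivative W1 t) (at t) \<and>
      (N has_vector_derivative (k1 t *\<^sub>R W1 t + k2 t *\<^sub>R W2 t)) (at t) \<and>
      (W1 has_vector_derivative (- (k1 t *\<^sub>R L t) - N t)) (at t) \<and>
      (W2 has_vector_derivative (- (k2 t *\<^sub>R L t))) (at t))"

definition null_helix :: "real set \<Rightarrow> (real \<Rightarrow> real ^ 4) \<Rightarrow> bool" where
  "null_helix I \<gamma> \<longleftrightarrow> cartan_curve I \<gamma> \<and>
    (\<exists>L N W1 W2 k1 k2. cartan_frame I \<gamma> L N W1 W2 k1 k2 \<and> k1 constant_on I \<and> k2 constant_on I)"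

definition speed :: "(real \<Rightarrow> real ^ 4) \<Rightarrow> real \<Rightarrow> real" where
  "speed \<beta> t = mink_norm (vderiv \<beta> t)"

definition unit_tangent :: "(real \<Rightarrow> real ^ 4) \<Rightarrow> real \<Rightarrow> real ^ 4" where
  "unit_tangent \<beta> t = vderiv \<beta> t /\<^sub>R speed \<beta> t"

definition first_curvature :: "(real \<Rightarrow> real ^ 4) \<Rightarrow> real \<Rightarrow> real" where
  "first_curvature \<beta> t = mink_norm (vderiv (unit_tangent \<beta>) t) / speed \<beta> t"

definition first_normal :: "(real \<Rightarrow> real ^ 4) \<Rightarrow> real \<Rightarrow> real ^ 4" where
  "first_normal \<beta> t =
    vderiv (unit_tangent \<beta>) t /\<^sub>R mink_norm (vderiv (unit_tangent \<beta>) t)"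

definition orth_component :: "real ^ 4 \<Rightarrow> real ^ 4 \<Rightarrow> real ^ 4" where
  "orth_component u x = x - (mink x u / mink u u) *\<^sub>R u"

definition second_curvature :: "(real \<Rightarrow> real ^ 4) \<Rightarrow> real \<Rightarrow> real" where
  "second_curvature \<beta> t = mink_norm
    (orth_component (unit_tangent \<beta> t) (vderiv (first_normal \<beta>) t /\<^sub>R speed \<beta> t))"

definition bertrand_curve :: "real set \<Rightarrow> (real \<Rightarrow> real ^ 4) \<Rightarrow> bool" where
  "bertrand_curve I \<beta> \<longleftrightarrow> regular_curve I \<beta> \<and>
    (\<forall>t\<in>I. \<not> null_vector (vderiv \<beta> t)) \<and>
    (\<forall>t\<in>I. vderiv (unit_tangent \<beta>) t \<noteq> 0 \<and> \<not> null_vector (vderiv (unit_tangent \<beta>) t)) \<and>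
    (\<exists>l m. \<forall>t\<in>I. l * first_curvature \<beta> t + m * second_curvature \<beta> t = 1)"

end

theory Submission
  imports Defs
begin

text \<open>
  Write \<open>\<beta>\<close> for the curve in question and \<open>C = coth \<theta>\<close>, which is nonzero. Its velocity
  \<open>a (L + C W\<^sub>2)\<close> is spacelike of constant length \<open>\<bar>a C\<bar>\<close>, because \<open>L\<close> is null and orthogonal
  to the unit vector \<open>W\<^sub>2\<close>. The derivative of \<open>L + C W\<^sub>2\<close> is \<open>W\<^sub>1 - C k\<^sub>2 L\<close>, which has
  length 1 whatever the value of \<open>k\<^sub>2\<close>, since adding a multiple of \<open>L\<close> to \<open>W\<^sub>1\<close> does not
  change the scalar square. Hence \<open>T'\<close> is spacelike and the first curvature is the nonzero
  constant \<open>1 / (\<bar>a\<bar> C\<^sup>2)\<close>. The Bertrand relation therefore holds with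
  \<open>\<lambda> = \<bar>a\<bar> C\<^sup>2\<close> and \<open>\<mu> = 0\<close>.

  It remains to see that \<open>\<beta>\<close> is smooth. If the curvatures belonging to the frame are constant,
  the Cartan equations are a linear system with constant coefficients, so all derivatives of
  \<open>\<beta>\<close> are combinations of the frame vectors with constant coefficients
  (\<open>smooth_on_frame_primitive\<close>). Being a null helix only provides some frame with constant
  curvatures, possibly different from the given one. Two frames along the same curve share
  \<open>L\<close>, \<open>W\<^sub>1\<close>, \<open>k\<^sub>1\<close>, \<open>N\<close> and the vector \<open>k\<^sub>2 W\<^sub>2\<close> (\<open>cartan_frame_unique\<close>), so the two
  functions \<open>k\<^sub>2\<close> agree up to a sign; by continuity the sign cannot change on an interval
  (\<open>cartan_frame_helix_curvatures\<close>).
\<close>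

lemma mink_linear [simp]:
  "mink (x + y) z = mink x z + mink y z" "mink z (x + y) = mink z x + mink z y"
  "mink (x - y) z = mink x z - mink y z" "mink z (x - y) = mink z x - mink z y"
  "mink (r *\<^sub>R x) z = r * mink x z" "mink z (r *\<^sub>R x) = r * mink z x"
  "mink (- x) z = - mink x z" "mink z (- x) = - mink z x"
  "mink 0 z = 0" "mink z 0 = 0"
  by (simp_all add: mink_def algebra_simps)

lemma mink_commute: "mink x y = mink y x"
  by (simp add: mink_def algebra_simps)

lemma continuous_on_mink:
  "continuous_on S f \<Longrightarrow> continuous_on S g \<Longrightarrow> continuous_on S (\<lambda>t. mink (f t) (g t))"
  unfolding mink_def by (intro continuous_intros)

lemma vderivI: "(f has_vector_derivative f') (at t) \<Longrightarrow> vderiv f t = f'"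
  by (simp add: vderiv_def vector_derivative_at)

lemma has_vector_derivative_eq_on_open:
  assumes "open I" "t \<in> I" "\<And>s. s \<in> I \<Longrightarrow> f s = g s" "(g has_vector_derivative d) (at t)"
  shows "(f has_vector_derivative d) (at t)"
  using has_vector_derivative_transform_within_open[OF assms(4,1,2)] assms(3) by simp

lemma cartan_frameD:
  assumes "cartan_frame I \<gamma> L N W1 W2 k1 k2" "t \<in> I"
  shows "L t = vderiv \<gamma> t"
    and "(L has_vector_derivative W1 t) (at t)"
    and "(N has_vector_derivative (k1 t *\<^sub>R W1 t + k2 t *\<^sub>R W2 t)) (at t)"
    and "(W1 has_vector_derivative (- (k1 t *\<^sub>R L t) - N t)) (at t)"
    and "(W2 has_vector_derivative (- (k2 t *\<^sub>R L t))) (at t)"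
    and "mink (L t) (L t) = 0" "mink (N t) (N t) = 0"
    and "mink (L t) (N t) = 1" "mink (N t) (L t) = 1"
    and "mink (W1 t) (W1 t) = 1" "mink (W2 t) (W2 t) = 1"
    and "mink (L t) (W1 t) = 0" "mink (W1 t) (L t) = 0"
    and "mink (L t) (W2 t) = 0" "mink (W2 t) (L t) = 0"
  using assms mink_commute
  unfolding cartan_frame_def pseudo_orthonormal_basis_def by metis+

text \<open>
  \<open>L\<close> is the velocity and \<open>W\<^sub>1\<close> its derivative. The scalar square of
  \<open>W\<^sub>1' = - k\<^sub>1 L - N\<close> is \<open>2 k\<^sub>1\<close>, which fixes \<open>k\<^sub>1\<close> and then \<open>N\<close>; the vector
  \<open>k\<^sub>2 W\<^sub>2\<close> can finally be read off from \<open>N'\<close>.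
\<close>
lemma cartan_frame_unique:
  assumes I: "open I"
    and F: "cartan_frame I \<gamma> L N W1 W2 k1 k2"
    and G: "cartan_frame I \<gamma> L' N' W1' W2' k1' k2'"
    and t: "t \<in> I"
  shows "k1 t = k1' t" and "k2 t *\<^sub>R W2 t = k2' t *\<^sub>R W2' t"
proof -
  have L: "L s = L' s" if "s \<in> I" for s
    using cartan_frameD(1)[OF F that] cartan_frameD(1)[OF G that] by simp
  have W1: "W1 s = W1' s" if s: "s \<in> I" for s
    using vector_derivative_unique_at cartan_frameD(2)[OF F s]
      has_vector_derivative_eq_on_open[OF I s L cartan_frameD(2)[OF G s]] by blast
  have dW1: "- (k1 s *\<^sub>R L s) - N s = - (k1' s *\<^sub>R L' s) - N' s" if s: "s \<in> I" for s
    using vector_derivative_unique_at cartan_frameD(4)[OF F s]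
      has_vector_derivative_eq_on_open[OF I s W1 cartan_frameD(4)[OF G s]] by blast
  have k1: "k1 s = k1' s" if s: "s \<in> I" for s
  proof -
    have "mink (- (k1 s *\<^sub>R L s) - N s) (- (k1 s *\<^sub>R L s) - N s) = 2 * k1 s"
      using cartan_frameD[OF F s] by simp
    moreover have "mink (- (k1' s *\<^sub>R L' s) - N' s) (- (k1' s *\<^sub>R L' s) - N' s) = 2 * k1' s"
      using cartan_frameD[OF G s] by simp
    ultimately show ?thesis
      using dW1[OF s] by simp
  qed
  have N: "N s = N' s" if s: "s \<in> I" for s
    using dW1[OF s] k1[OF s] L[OF s] by simp
  have "k1 t *\<^sub>R W1 t + k2 t *\<^sub>R W2 t = k1' t *\<^sub>R W1' t + k2' t *\<^sub>R W2' t"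
    using vector_derivative_unique_at cartan_frameD(3)[OF F t]
      has_vector_derivative_eq_on_open[OF I t N cartan_frameD(3)[OF G t]] by blast
  then show "k2 t *\<^sub>R W2 t = k2' t *\<^sub>R W2' t"
    using k1[OF t] W1[OF t] by simp
  show "k1 t = k1' t" by (rule k1[OF t])
qed

text \<open>
  If \<open>k\<^sub>2 W\<^sub>2 = q V\<close> with \<open>q\<close> the constant curvature and \<open>V\<close> the fourth vector of the
  frame witnessing the helix, then \<open>k\<^sub>2 = q \<langle>V, W\<^sub>2\<rangle>\<close> is continuous and
  \<open>k\<^sub>2\<^sup>2 = q\<^sup>2\<close>, so \<open>k\<^sub>2\<close> takes finitely many values on a connected set.
\<close>
lemma cartan_frame_helix_curvatures:
  assumes helix: "null_helix I \<gamma>"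
    and F: "cartan_frame I \<gamma> L N W1 W2 k1 k2"
  shows "k1 constant_on I" and "k2 constant_on I"
proof -
  have I: "open I" "connected I"
    using helix is_interval_connected
    unfolding null_helix_def cartan_curve_def null_curve_def regular_curve_def curve_def by auto
  obtain L' N' W1' V k1' k2' where G: "cartan_frame I \<gamma> L' N' W1' V k1' k2'"
    and "k1' constant_on I" "k2' constant_on I"
    using helix unfolding null_helix_def by blast
  then obtain p q where pq: "\<And>t. t \<in> I \<Longrightarrow> k1' t = p" "\<And>t. t \<in> I \<Longrightarrow> k2' t = q"
    unfolding constant_on_def by metis
  show "k1 constant_on I"
    using cartan_frame_unique(1)[OF I(1) F G] pq(1) unfolding constant_on_def by auto
  have kV: "k2 t *\<^sub>R W2 t = q *\<^sub>R V t" if "t \<in> I" for t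
    using cartan_frame_unique(2)[OF I(1) F G that] pq(2)[OF that] by simp
  have k2: "k2 t = q * mink (V t) (W2 t)" if t: "t \<in> I" for t
    using arg_cong[OF kV[OF t], of "\<lambda>x. mink x (W2 t)"] cartan_frameD(11)[OF F t] by simp
  have sq: "k2 t * k2 t = q * q" if t: "t \<in> I" for t
    using arg_cong[OF kV[OF t], of "\<lambda>x. mink x x"]
      cartan_frameD(11)[OF F t] cartan_frameD(11)[OF G t] by simp
  have "continuous_on I V" "continuous_on I W2"
    using cartan_frameD(5)[OF F] cartan_frameD(5)[OF G]
    by (auto intro!: continuous_at_imp_continuous_on has_vector_derivative_continuous)
  then have "continuous_on I (\<lambda>t. q * mink (V t) (W2 t))"
    by (intro continuous_intros continuous_on_mink)
  then have "continuous_on I k2"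
    using k2 continuous_on_cong by force
  moreover have "k2 ` I \<subseteq> {q, - q}"
    using sq square_eq_iff by blast
  ultimately show "k2 constant_on I"
    using continuous_finite_range_constant[OF I(2)] finite_subset by (metis finite.emptyI finite_insert)
qed

text \<open>
  The span of the frame over the constants is closed under differentiation, so every derivative
  of \<open>\<beta>\<close> of order at least one stays in it and is again differentiable.
\<close>
lemma smooth_on_frame_primitive:
  fixes \<beta> :: "real \<Rightarrow> real ^ 4"
  assumes I: "open I"
    and F: "cartan_frame I \<gamma> L N W1 W2 k1 k2"
    and k: "k1 constant_on I" "k2 constant_on I"
    and \<beta>: "\<And>t. t \<in> I \<Longrightarrow> (\<beta> has_vector_derivative (x *\<^sub>R L t + y *\<^sub>R W2 t)) (at t)"
  shows "smooth_on I \<beta>"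
proof -
  obtain \<kappa> \<tau> where \<kappa>\<tau>: "\<And>t. t \<in> I \<Longrightarrow> k1 t = \<kappa>" "\<And>t. t \<in> I \<Longrightarrow> k2 t = \<tau>"
    using k unfolding constant_on_def by metis
  define comb where
    "comb = (\<lambda>p q r s t. p *\<^sub>R L t + q *\<^sub>R N t + r *\<^sub>R W1 t + s *\<^sub>R W2 t)"
  have comb_deriv: "(comb p q r s has_vector_derivative
      comb (- r * \<kappa> - s * \<tau>) (- r) (p + q * \<kappa>) (q * \<tau>) t) (at t)" if t: "t \<in> I" for p q r s t
  proof -
    have "(comb p q r s has_vector_derivative
        p *\<^sub>R W1 t + q *\<^sub>R (k1 t *\<^sub>R W1 t + k2 t *\<^sub>R W2 t)
        + r *\<^sub>R (- (k1 t *\<^sub>R L t) - N t) + s *\<^sub>R (- (k2 t *\<^sub>R L t))) (at t)"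
      unfolding comb_def
      by (intro has_vector_derivative_add
          bounded_linear.has_vector_derivative[OF bounded_linear_scaleR_right]
          cartan_frameD[OF F t])
    then show ?thesis
      using \<kappa>\<tau>[OF t] by (simp add: comb_def algebra_simps)
  qed
  have derivs: "\<exists>p q r s. \<forall>t\<in>I. (vderiv ^^ Suc n) \<beta> t = comb p q r s t" for n
  proof (induction n)
    case 0
    have "\<forall>t\<in>I. (vderiv ^^ Suc 0) \<beta> t = comb x 0 0 y t"
      using vderivI[OF \<beta>] by (simp add: comb_def)
    then show ?case by blast
  next
    case (Suc n)
    then obtain p q r s where IH: "\<And>t. t \<in> I \<Longrightarrow> (vderiv ^^ Suc n) \<beta> t = comb p q r s t"
      by blast
    have "(vderiv ^^ Suc (Suc n)) \<beta> t = comb (- r * \<kappa> - s * \<tau>) (- r) (p + q * \<kappa>) (q * \<tau>) t"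
      if t: "t \<in> I" for t
      using vderivI[OF has_vector_derivative_eq_on_open[OF I t IH comb_deriv[OF t]]] by simp
    then show ?case by blast
  qed
  have "(vderiv ^^ n) \<beta> differentiable at t" if t: "t \<in> I" for n t
  proof (cases n)
    case 0
    then show ?thesis
      using \<beta>[OF t] by (auto intro: differentiableI_vector)
  next
    case (Suc m)
    obtain p q r s where "\<And>u. u \<in> I \<Longrightarrow> (vderiv ^^ n) \<beta> u = comb p q r s u"
      using derivs[of m] Suc by blast
    from has_vector_derivative_eq_on_open[OF I t this comb_deriv[OF t]]
    show ?thesis by (rule differentiableI_vector)
  qed
  then show ?thesis
    unfolding smooth_on_def by blast
qed

lemma coth_nonzero: "x \<noteq> 0 \<Longrightarrow> coth x \<noteq> 0"
  using cosh_real_pos[of x] by (simp add: coth_def)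

theorem theorem3p1:
  fixes I :: "real set" and \<gamma> L N W1 W2 A B :: "real \<Rightarrow> real ^ 4"
    and k1 k2 :: "real \<Rightarrow> real" and a \<theta> :: real and c :: "real ^ 4"
  assumes "null_helix I \<gamma>" and "pseudo_arc I \<gamma>" and "\<gamma> ` I \<subseteq> de_sitter3"
    and "cartan_frame I \<gamma> L N W1 W2 k1 k2"
    and "a \<noteq> 0" and "\<theta> \<noteq> 0"
    and "\<And>s. s \<in> I \<Longrightarrow> (A has_vector_derivative L s) (at s)"
    and "\<And>s. s \<in> I \<Longrightarrow> (B has_vector_derivative W2 s) (at s)"
  shows "bertrand_curve I (\<lambda>s. a *\<^sub>R A s + (a * coth \<theta>) *\<^sub>R B s + c)"
proof -
  note F = assms(4)
  define C where "C = coth \<theta>"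
  define \<beta> where "\<beta> = (\<lambda>s. a *\<^sub>R A s + (a * C) *\<^sub>R B s + c)"
  have C: "C \<noteq> 0"
    unfolding C_def using assms(6) by (rule coth_nonzero)
  have I: "I \<noteq> {}" "open I" "is_interval I"
    using assms(1)
    unfolding null_helix_def cartan_curve_def null_curve_def regular_curve_def curve_def by auto
  have \<beta>': "(\<beta> has_vector_derivative (a *\<^sub>R L t + (a * C) *\<^sub>R W2 t)) (at t)" if t: "t \<in> I" for t
    unfolding \<beta>_def
    by (intro iffD2[OF has_vector_derivative_add_const] has_vector_derivative_add
        bounded_linear.has_vector_derivative[OF bounded_linear_scaleR_right] assms(7,8) t)
  have vel: "vderiv \<beta> t = a *\<^sub>R L t + (a * C) *\<^sub>R W2 t" if "t \<in> I" for t
    by (rule vderivI[OF \<beta>'[OF that]])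
  have vel_sq: "mink (vderiv \<beta> t) (vderiv \<beta> t) = (a * C)\<^sup>2" if t: "t \<in> I" for t
    using cartan_frameD[OF F t] by (simp add: vel[OF t] power2_eq_square)
  have speed: "speed \<beta> t = \<bar>a * C\<bar>" if "t \<in> I" for t
    by (simp add: speed_def mink_norm_def vel_sq[OF that])
  define r where "r = a / \<bar>a * C\<bar>"
  have r: "\<bar>r\<bar> = 1 / \<bar>C\<bar>"
    using assms(5) by (simp add: r_def abs_mult)
  have tangent: "unit_tangent \<beta> t = r *\<^sub>R (L t + C *\<^sub>R W2 t)" if t: "t \<in> I" for t
    by (simp add: unit_tangent_def speed[OF t] vel[OF t] r_def algebra_simps divide_inverse)
  have tangent': "vderiv (unit_tangent \<beta>) t = r *\<^sub>R (W1 t + C *\<^sub>R (- (k2 t *\<^sub>R L t)))"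
    if t: "t \<in> I" for t
  proof (rule vderivI[OF has_vector_derivative_eq_on_open[OF I(2) t tangent]])
    show "((\<lambda>t. r *\<^sub>R (L t + C *\<^sub>R W2 t)) has_vector_derivative
        r *\<^sub>R (W1 t + C *\<^sub>R (- (k2 t *\<^sub>R L t)))) (at t)"
      by (intro has_vector_derivative_add
          bounded_linear.has_vector_derivative[OF bounded_linear_scaleR_right]
          cartan_frameD[OF F t])
  qed
  have tangent'_sq: "mink (vderiv (unit_tangent \<beta>) t) (vderiv (unit_tangent \<beta>) t) = r\<^sup>2"
    if t: "t \<in> I" for t
    using cartan_frameD[OF F t] by (simp add: tangent'[OF t] power2_eq_square)
  have curvature: "first_curvature \<beta> t = 1 / (\<bar>a\<bar> * C\<^sup>2)" if t: "t \<in> I" for t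
  proof -
    have "first_curvature \<beta> t = \<bar>r\<bar> / \<bar>a * C\<bar>"
      by (simp add: first_curvature_def mink_norm_def tangent'_sq[OF t] speed[OF t])
    also have "\<dots> = 1 / (\<bar>a\<bar> * (\<bar>C\<bar> * \<bar>C\<bar>))"
      by (simp add: r abs_mult)
    finally show ?thesis
      by (simp add: power2_eq_square)
  qed
  have "smooth_on I \<beta>"
    by (rule smooth_on_frame_primitive[OF I(2) F
          cartan_frame_helix_curvatures[OF assms(1) F] \<beta>'])
  \<comment> \<open>A nonzero scalar square excludes the zero vector and the null vectors at once.\<close>
  moreover have "vderiv \<beta> t \<noteq> 0 \<and> \<not> null_vector (vderiv \<beta> t)" if t: "t \<in> I" for t
    using vel_sq[OF t] assms(5) C by (auto simp: null_vector_def)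
  moreover have "vderiv (unit_tangent \<beta>) t \<noteq> 0 \<and> \<not> null_vector (vderiv (unit_tangent \<beta>) t)"
    if t: "t \<in> I" for t
    using tangent'_sq[OF t] r C by (auto simp: null_vector_def)
  moreover have "\<forall>t\<in>I. (\<bar>a\<bar> * C\<^sup>2) * first_curvature \<beta> t + 0 * second_curvature \<beta> t = 1"
    using assms(5) C by (simp add: curvature)
  ultimately have "bertrand_curve I \<beta>"
    unfolding bertrand_curve_def regular_curve_def curve_def using I by blast
  then show ?thesis
    by (simp add: \<beta>_def C_def)
qed

end
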